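(* Let $\mathbb{K}$ be $\mathbb{R}$ or $\mathbb{C}$, let $\hbar\in\mathbb{K}$ be nonzero and let $\alpha\in\mathbb{K}$. Let $A_\hbar$, $L$, $V$, $V_{(2)}=\mathrm{Sym}^2(V)\subset V^{\otimes 2}$ and $L_{(2)}=\frac12(\mathrm{id}+P)\,L_1\,(\mathrm{id}+P)$ be as defined in the context. Then the matrix $L_{(2)}$, restricted to the symmetric component $V_{(2)}$ of $V^{\otimes 2}$ (that is, regarded as a $3\times 3$ matrix with entries in $A_\hbar$), satisfies the Cayley–Hamilton identity $$L_{(2)}^3-4\hbar\,L_{(2)}^2+4(\alpha+\hbar^2)\,L_{(2)}-8\hbar\alpha\,\mathrm{id}=0 .$$
   Context: The Lie algebra $gl(2)_\hbar$ over $\mathbb{K}$ is generated by $a,b,c,d$ with brackets $$[a,b]=\hbar b,\quad [a,c]=-\hbar c,\quad [a,d]=0,\quad [b,c]=\hbar(a-d),\quad [b,d]=\hbar b,\quad [c,d]=-\hbar c .$$ In its enveloping algebra $U(gl(2)_\hbar)$ the elements $\mathrm{tr}=a+d$ and $\triangle=ad-(bc+cb)/2$ are central. Define $$A_\hbar=U(gl(2)_\hbar)/\{\mathrm{tr},\ \triangle-\alpha\},$$ where $\{X\}$ denotes the two-sided ideal generated by $X$ (so $d=-a$ and $\triangle=\alpha$ in $A_\hbar$). Let $L=\begin{pmatrix} a&b\\ c&d\end{pmatrix}\in M_2(A_\hbar)$. Let $V$ be a 2-dimensional $\mathbb{K}$-vector space with basis $(v_1,v_2)$; $L$ is regarded as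 the operator $V\to V\otimes A_\hbar$, $v_1\mapsto v_1\otimes a+v_2\otimes c$, $v_2\mapsto v_1\otimes b+v_2\otimes d$. Put $L_1=L\otimes \mathrm{id}\in \mathrm{End}(V^{\otimes 2})\otimes A_\hbar\cong M_4(A_\hbar)$, and let $P$ be the flip on $V^{\otimes 2}$ (with scalar entries). Let $$L_{(2)}=2\,S^{(2)}L_1S^{(2)}=\tfrac12(\mathrm{id}+P)\,L_1\,(\mathrm{id}+P),\qquad S^{(2)}=\tfrac12(\mathrm{id}+P).$$ Products are matrix products over $A_\hbar$. The operator $L_{(2)}$ preserves the symmetric component $V_{(2)}$; in the basis $v_1^{\otimes 2},\ v_1\otimes v_2+v_2\otimes v_1,\ v_2^{\otimes 2}$ of $V_{(2)}$ its restriction is the matrix $$L_{(2)}=\begin{pmatrix}2a&2b&0\\ c&a+d&b\\ 0&2c&2d\end{pmatrix}=\begin{pmatrix}2a&2b&0\\ c&0&b\\ 0&2c&-2a\end{pmatrix}\in M_3(A_\hbar),$$ with columns giving the coordinates of the images of the basis vectors. *)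

theory Defs
  imports
    "HOL-Algebra.Algebra"
    "HOL-Algebra.Algebraic_Closure_Type"
    "HOL-Library.Poly_Mapping"
    Complex_Main
begin

section \<open>Free associative algebras and enveloping algebras\<close>

text \<open>
  The words over an alphabet, written additively because the convolution product of
  finitely supported functions expects an additive monoid.  The type of finitely supported
  functions from words to \<open>'k\<close> is then the free associative algebra, i.e.\ the tensor algebra of
  the vector space with the alphabet as its basis.
\<close>

datatype 'g fword = Word "'g list"

instantiation fword :: (type) monoid_add
begin

definition zero_fword :: "'a fword" where "0 = Word []"

fun plus_fword :: "'a fword \<Rightarrow> 'a fword \<Rightarrow> 'a fword" where
  "Word u + Word v = Word (u @ v)"

instance
proof
  fix x y z :: "'a fword"
  show "x + y + z = x + (y + z)" by (cases x; cases y; cases z) simp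
  show "0 + x = x" "x + 0 = x" by (cases x; simp add: zero_fword_def)+
qed

end

type_synonym ('g, 'k) tensor_alg = "'g fword \<Rightarrow>\<^sub>0 'k"

abbreviation tensor_ring :: "('g, 'k::field) tensor_alg ring" where
  "tensor_ring \<equiv> ring_of_type_algebra"

definition tensor_incl :: "('g::finite \<Rightarrow> 'k::field) \<Rightarrow> ('g, 'k) tensor_alg" where
  "tensor_incl x = (\<Sum>g\<in>UNIV. Poly_Mapping.single (Word [g]) (x g))"

definition tensor_const :: "'k::field \<Rightarrow> ('g, 'k) tensor_alg" where
  "tensor_const k = Poly_Mapping.single 0 k"

text \<open>
  The ideal defining the enveloping algebra of the Lie algebra on the vector space
  \<open>'g \<Rightarrow> 'k\<close> with bracket \<open>br\<close>; \<^const>\<open>genideal\<close> is the generated two-sided ideal.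
\<close>

definition env_ideal ::
  "(('g::finite \<Rightarrow> 'k::field) \<Rightarrow> ('g \<Rightarrow> 'k) \<Rightarrow> ('g \<Rightarrow> 'k)) \<Rightarrow> ('g, 'k) tensor_alg set" where
  "env_ideal br = genideal tensor_ring
     {tensor_incl x * tensor_incl y - tensor_incl y * tensor_incl x - tensor_incl (br x y) | x y. True}"

definition env_alg ::
  "(('g::finite \<Rightarrow> 'k::field) \<Rightarrow> ('g \<Rightarrow> 'k) \<Rightarrow> ('g \<Rightarrow> 'k)) \<Rightarrow> ('g, 'k) tensor_alg set ring" where
  "env_alg br = tensor_ring Quot env_ideal br"

definition env_class ::
  "(('g::finite \<Rightarrow> 'k::field) \<Rightarrow> ('g \<Rightarrow> 'k) \<Rightarrow> ('g \<Rightarrow> 'k)) \<Rightarrow>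
    ('g, 'k) tensor_alg \<Rightarrow> ('g, 'k) tensor_alg set" where
  "env_class br t = env_ideal br +>\<^bsub>tensor_ring\<^esub> t"


section \<open>The Lie algebra \<open>gl(2)\<close> with parameter and the algebra \<open>A\<close>\<close>

datatype gl2 = Ga | Gb | Gc | Gd

lemma UNIV_gl2: "UNIV = {Ga, Gb, Gc, Gd}"
  using gl2.exhaust by blast

instance gl2 :: finite
  by standard (simp add: UNIV_gl2)

definition unit_vec :: "'g \<Rightarrow> 'g \<Rightarrow> 'k::field" where
  "unit_vec g = (\<lambda>i. if i = g then 1 else 0)"

fun gl2_basis_bracket :: "'k::field \<Rightarrow> gl2 \<Rightarrow> gl2 \<Rightarrow> gl2 \<Rightarrow> 'k" where
  "gl2_basis_bracket h Ga Gb = (\<lambda>i. h * unit_vec Gb i)"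
| "gl2_basis_bracket h Ga Gc = (\<lambda>i. - h * unit_vec Gc i)"
| "gl2_basis_bracket h Ga Gd = (\<lambda>i. 0)"
| "gl2_basis_bracket h Gb Gc = (\<lambda>i. h * (unit_vec Ga i - unit_vec Gd i))"
| "gl2_basis_bracket h Gb Gd = (\<lambda>i. h * unit_vec Gb i)"
| "gl2_basis_bracket h Gc Gd = (\<lambda>i. - h * unit_vec Gc i)"
| "gl2_basis_bracket h Gb Ga = (\<lambda>i. - h * unit_vec Gb i)"
| "gl2_basis_bracket h Gc Ga = (\<lambda>i. h * unit_vec Gc i)"
| "gl2_basis_bracket h Gd Ga = (\<lambda>i. 0)"
| "gl2_basis_bracket h Gc Gb = (\<lambda>i. - h * (unit_vec Ga i - unit_vec Gd i))"
| "gl2_basis_bracket h Gd Gb = (\<lambda>i. - h * unit_vec Gb i)"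
| "gl2_basis_bracket h Gd Gc = (\<lambda>i. h * unit_vec Gc i)"
| "gl2_basis_bracket h Ga Ga = (\<lambda>i. 0)"
| "gl2_basis_bracket h Gb Gb = (\<lambda>i. 0)"
| "gl2_basis_bracket h Gc Gc = (\<lambda>i. 0)"
| "gl2_basis_bracket h Gd Gd = (\<lambda>i. 0)"

definition gl2_bracket :: "'k::field \<Rightarrow> (gl2 \<Rightarrow> 'k) \<Rightarrow> (gl2 \<Rightarrow> 'k) \<Rightarrow> (gl2 \<Rightarrow> 'k)" where
  "gl2_bracket h x y = (\<lambda>i. \<Sum>p\<in>UNIV. \<Sum>q\<in>UNIV. x p * y q * gl2_basis_bracket h p q i)"

lemma gl2_bracket_alternating: "gl2_bracket h x x = (\<lambda>i. 0)"
  by (rule ext) (simp add: gl2_bracket_def UNIV_gl2 algebra_simps)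

lemma gl2_bracket_simps:
  "gl2_bracket h x y Ga = h * (x Gb * y Gc - x Gc * y Gb)"
  "gl2_bracket h x y Gb = h * (x Ga * y Gb - x Gb * y Ga + x Gb * y Gd - x Gd * y Gb)"
  "gl2_bracket h x y Gc = h * (x Gc * y Ga - x Ga * y Gc + x Gd * y Gc - x Gc * y Gd)"
  "gl2_bracket h x y Gd = h * (x Gc * y Gb - x Gb * y Gc)"
  by (simp_all add: gl2_bracket_def UNIV_gl2 unit_vec_def algebra_simps)

lemma gl2_bracket_Jacobi:
  "gl2_bracket h x (gl2_bracket h y z) i + gl2_bracket h y (gl2_bracket h z x) i
     + gl2_bracket h z (gl2_bracket h x y) i = 0"
  by (cases i) (simp_all add: gl2_bracket_simps algebra_simps)

type_synonym 'k U_elem = "(gl2, 'k) tensor_alg set"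

abbreviation U_alg :: "'k::field \<Rightarrow> 'k U_elem ring" where
  "U_alg h \<equiv> env_alg (gl2_bracket h)"

definition U_gen :: "'k::field \<Rightarrow> gl2 \<Rightarrow> 'k U_elem" where
  "U_gen h g = env_class (gl2_bracket h) (tensor_incl (unit_vec g))"

definition U_const :: "'k::field \<Rightarrow> 'k \<Rightarrow> 'k U_elem" where
  "U_const h k = env_class (gl2_bracket h) (tensor_const k)"

definition U_trace :: "'k::field \<Rightarrow> 'k U_elem" where
  "U_trace h = U_gen h Ga \<oplus>\<^bsub>U_alg h\<^esub> U_gen h Gd"

definition U_Delta :: "'k::field \<Rightarrow> 'k U_elem" where
  "U_Delta h = U_gen h Ga \<otimes>\<^bsub>U_alg h\<^esub> U_gen h Gd
     \<ominus>\<^bsub>U_alg h\<^esub> U_const h (1/2) \<otimes>\<^bsub>U_alg h\<^esub>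
        (U_gen h Gb \<otimes>\<^bsub>U_alg h\<^esub> U_gen h Gc \<oplus>\<^bsub>U_alg h\<^esub> U_gen h Gc \<otimes>\<^bsub>U_alg h\<^esub> U_gen h Gb)"

definition A_ideal :: "'k::field \<Rightarrow> 'k \<Rightarrow> 'k U_elem set" where
  "A_ideal h \<alpha> = genideal (U_alg h) {U_trace h, U_Delta h \<ominus>\<^bsub>U_alg h\<^esub> U_const h \<alpha>}"

type_synonym 'k A_elem = "'k U_elem set"

definition A_alg :: "'k::field \<Rightarrow> 'k \<Rightarrow> 'k A_elem ring" where
  "A_alg h \<alpha> = U_alg h Quot A_ideal h \<alpha>"

definition A_gen :: "'k::field \<Rightarrow> 'k \<Rightarrow> gl2 \<Rightarrow> 'k A_elem" where
  "A_gen h \<alpha> g = A_ideal h \<alpha> +>\<^bsub>U_alg h\<^esub> U_gen h g"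

text \<open>
  The structure map of the \<open>'k\<close>-algebra \<open>A\<close>: since \<open>Quot\<close> yields a plain ring, multiplication by the
  scalar \<open>k\<close> is written as multiplication by \<open>A_const h \<alpha> k\<close>.
\<close>

definition A_const :: "'k::field \<Rightarrow> 'k \<Rightarrow> 'k \<Rightarrow> 'k A_elem" where
  "A_const h \<alpha> k = A_ideal h \<alpha> +>\<^bsub>U_alg h\<^esub> U_const h k"


section \<open>Matrices over a ring\<close>

text \<open>Rows and columns are indexed by finite types, so that no entry lies out of range.\<close>

type_synonym ('i, 'j, 'a) matr = "'i \<Rightarrow> 'j \<Rightarrow> 'a"

definition matr_mult ::
  "('a, 'm) ring_scheme \<Rightarrow> ('i, 'l::finite, 'a) matr \<Rightarrow> ('l, 'j, 'a) matr \<Rightarrow> ('i, 'j, 'a) matr" where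
  "matr_mult R T W = (\<lambda>i j. finsum R (\<lambda>k. T i k \<otimes>\<^bsub>R\<^esub> W k j) UNIV)"

definition matr_carrier :: "('a, 'm) ring_scheme \<Rightarrow> ('i, 'j, 'a) matr set" where
  "matr_carrier R = {T. \<forall>i j. T i j \<in> carrier R}"

definition matr_scale ::
  "('a, 'm) ring_scheme \<Rightarrow> 'a \<Rightarrow> ('i, 'j, 'a) matr \<Rightarrow> ('i, 'j, 'a) matr" where
  "matr_scale R r T = (\<lambda>i j. r \<otimes>\<^bsub>R\<^esub> T i j)"

definition matr_ring :: "('a, 'm) ring_scheme \<Rightarrow> ('i::finite, 'i, 'a) matr ring" where
  "matr_ring R = \<lparr>carrier = matr_carrier R, monoid.mult = matr_mult R,
     one = (\<lambda>i j. if i = j then \<one>\<^bsub>R\<^esub> else \<zero>\<^bsub>R\<^esub>),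
     ring.zero = (\<lambda>i j. \<zero>\<^bsub>R\<^esub>), add = (\<lambda>T W i j. T i j \<oplus>\<^bsub>R\<^esub> W i j)\<rparr>"

definition kronecker ::
  "('a, 'm) ring_scheme \<Rightarrow> ('i, 'j, 'a) matr \<Rightarrow> ('p, 'q, 'a) matr \<Rightarrow> ('i \<times> 'p, 'j \<times> 'q, 'a) matr" where
  "kronecker R T W = (\<lambda>(i, p) (j, q). T i j \<otimes>\<^bsub>R\<^esub> W p q)"


section \<open>The operator \<open>L\<close> and its symmetric square\<close>

datatype vb = V1 | V2

lemma UNIV_vb: "UNIV = {V1, V2}"
  using vb.exhaust by blast

instance vb :: finite
  by standard (simp add: UNIV_vb)

definition L_matr :: "'k::field \<Rightarrow> 'k \<Rightarrow> (vb, vb, 'k A_elem) matr" where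
  "L_matr h \<alpha> i j =
     (case (i, j) of
        (V1, V1) \<Rightarrow> A_gen h \<alpha> Ga
      | (V1, V2) \<Rightarrow> A_gen h \<alpha> Gb
      | (V2, V1) \<Rightarrow> A_gen h \<alpha> Gc
      | (V2, V2) \<Rightarrow> A_gen h \<alpha> Gd)"

text \<open>The pair \<open>(i, j)\<close> stands for the basis vector \<open>v\<^sub>i \<otimes> v\<^sub>j\<close> of the tensor square.\<close>

definition L1_matr :: "'k::field \<Rightarrow> 'k \<Rightarrow> (vb \<times> vb, vb \<times> vb, 'k A_elem) matr" where
  "L1_matr h \<alpha> = kronecker (A_alg h \<alpha>) (L_matr h \<alpha>) \<one>\<^bsub>matr_ring (A_alg h \<alpha>)\<^esub>"

definition flip_matr :: "('a, 'm) ring_scheme \<Rightarrow> (vb \<times> vb, vb \<times> vb, 'a) matr" where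
  "flip_matr R = (\<lambda>(i, p) (j, q). if i = q \<and> p = j then \<one>\<^bsub>R\<^esub> else \<zero>\<^bsub>R\<^esub>)"

definition L2_full :: "'k::field \<Rightarrow> 'k \<Rightarrow> (vb \<times> vb, vb \<times> vb, 'k A_elem) matr" where
  "L2_full h \<alpha> =
     (let A = A_alg h \<alpha>; M = matr_ring A; Q = \<one>\<^bsub>M\<^esub> \<oplus>\<^bsub>M\<^esub> flip_matr A
      in matr_scale A (A_const h \<alpha> (1/2)) (Q \<otimes>\<^bsub>M\<^esub> L1_matr h \<alpha> \<otimes>\<^bsub>M\<^esub> Q))"

text \<open>
  The three basis vectors of the symmetric square:
  \<open>v\<^sub>1 \<otimes> v\<^sub>1\<close>, \<open>v\<^sub>1 \<otimes> v\<^sub>2 + v\<^sub>2 \<otimes> v\<^sub>1\<close> and \<open>v\<^sub>2 \<otimes> v\<^sub>2\<close>.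
\<close>

datatype sb = S11 | S12 | S22

lemma UNIV_sb: "UNIV = {S11, S12, S22}"
  using sb.exhaust by blast

instance sb :: finite
  by standard (simp add: UNIV_sb)

fun sym_support :: "sb \<Rightarrow> (vb \<times> vb) set" where
  "sym_support S11 = {(V1, V1)}"
| "sym_support S12 = {(V1, V2), (V2, V1)}"
| "sym_support S22 = {(V2, V2)}"

definition sym_basis :: "('a, 'm) ring_scheme \<Rightarrow> (vb \<times> vb, sb, 'a) matr" where
  "sym_basis R = (\<lambda>p s. if p \<in> sym_support s then \<one>\<^bsub>R\<^esub> else \<zero>\<^bsub>R\<^esub>)"

text \<open>
  The matrix of the restriction of \<open>T\<close> to the symmetric square: column \<open>s\<close> holds the coordinates
  of the image under \<open>T\<close> of the basis vector \<open>s\<close>.  For the matrix \<^const>\<open>L2_full\<close> it is computed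
  (hence shown to exist) in \<open>L2_sym_spec\<close> below.
\<close>

definition sym_restriction ::
  "('a, 'm) ring_scheme \<Rightarrow> (vb \<times> vb, vb \<times> vb, 'a) matr \<Rightarrow> (sb, sb, 'a) matr" where
  "sym_restriction R T =
     (THE M. M \<in> matr_carrier R \<and> matr_mult R (sym_basis R) M = matr_mult R T (sym_basis R))"

definition L2_sym :: "'k::field \<Rightarrow> 'k \<Rightarrow> (sb, sb, 'k A_elem) matr" where
  "L2_sym h \<alpha> = sym_restriction (A_alg h \<alpha>) (L2_full h \<alpha>)"

text \<open>Existence of the restriction, and its matrix.\<close>

lemma ring_tensor_ring: "ring (tensor_ring :: ('g, 'k::field) tensor_alg ring)"
proof -
  have "\<exists>y. x + y = 0" for x :: "('g, 'k) tensor_alg"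
    using add.right_inverse by blast
  thus ?thesis
    unfolding ring_of_type_algebra_def using add.right_inverse
    by unfold_locales (auto simp: algebra_simps Units_def)
qed

lemma ideal_env_ideal: "ideal (env_ideal br) (tensor_ring :: ('g::finite, 'k::field) tensor_alg ring)"
  unfolding env_ideal_def
  by (rule ring.genideal_ideal[OF ring_tensor_ring]) (simp add: ring_of_type_algebra_def)

lemma ring_env_alg: "ring (env_alg br)"
  unfolding env_alg_def by (rule ideal.quotient_is_ring[OF ideal_env_ideal])

lemma env_class_hom: "env_class br \<in> ring_hom tensor_ring (env_alg br)"
  unfolding env_class_def[abs_def] env_alg_def by (rule ideal.rcos_ring_hom[OF ideal_env_ideal])

lemma env_class_closed: "env_class br t \<in> carrier (env_alg br)"
  using ring_hom_closed[OF env_class_hom] by (simp add: ring_of_type_algebra_def)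

lemma ideal_A_ideal: "ideal (A_ideal h \<alpha>) (U_alg h)"
proof -
  interpret ring "U_alg h" by (rule ring_env_alg)
  show ?thesis
    unfolding A_ideal_def U_trace_def U_Delta_def U_gen_def U_const_def
    by (rule genideal_ideal) (simp add: env_class_closed)
qed

lemma ring_A_alg: "ring (A_alg h \<alpha>)"
  unfolding A_alg_def by (rule ideal.quotient_is_ring[OF ideal_A_ideal])

lemma A_class_hom: "(\<lambda>u. A_ideal h \<alpha> +>\<^bsub>U_alg h\<^esub> u) \<in> ring_hom (U_alg h) (A_alg h \<alpha>)"
  unfolding A_alg_def by (rule ideal.rcos_ring_hom[OF ideal_A_ideal])

lemma A_gen_closed: "A_gen h \<alpha> g \<in> carrier (A_alg h \<alpha>)"
  unfolding A_gen_def U_gen_def by (rule ring_hom_closed[OF A_class_hom env_class_closed])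

lemma A_const_closed: "A_const h \<alpha> k \<in> carrier (A_alg h \<alpha>)"
  unfolding A_const_def U_const_def by (rule ring_hom_closed[OF A_class_hom env_class_closed])

lemma A_const_add: "A_const h \<alpha> (k + m) = A_const h \<alpha> k \<oplus>\<^bsub>A_alg h \<alpha>\<^esub> A_const h \<alpha> m"
proof -
  have "U_const h (k + m) = U_const h k \<oplus>\<^bsub>U_alg h\<^esub> U_const h m"
    unfolding U_const_def
    using ring_hom_add[OF env_class_hom, of "tensor_const k" "tensor_const m" "gl2_bracket h"]
    by (simp add: ring_of_type_algebra_def tensor_const_def Poly_Mapping.single_add)
  thus ?thesis
    unfolding A_const_def
    using ring_hom_add[OF A_class_hom, of "U_const h k" h "U_const h m" \<alpha>]
    by (simp add: U_const_def env_class_closed)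
qed

lemma A_const_one: "A_const h \<alpha> 1 = \<one>\<^bsub>A_alg h \<alpha>\<^esub>"
proof -
  have "U_const h 1 = \<one>\<^bsub>U_alg h\<^esub>"
    unfolding U_const_def
    using ring_hom_one[OF env_class_hom, of "gl2_bracket h"]
    by (simp add: ring_of_type_algebra_def tensor_const_def)
  thus ?thesis
    unfolding A_const_def using ring_hom_one[OF A_class_hom] by metis
qed

lemma UNIV_vb_prod: "UNIV = {(V1, V1), (V1, V2), (V2, V1), (V2, V2)}"
  by (auto simp: UNIV_vb simp flip: UNIV_Times_UNIV)

lemma vb_prod_cases:
  obtains "p = (V1, V1)" | "p = (V1, V2)" | "p = (V2, V1)" | "p = (V2, V2)"
  using UNIV_vb_prod by blast

definition L2_explicit :: "'k::field \<Rightarrow> 'k \<Rightarrow> (sb, sb, 'k A_elem) matr" where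
  "L2_explicit h \<alpha> i j =
     (let A = A_alg h \<alpha>; a = A_gen h \<alpha> Ga; b = A_gen h \<alpha> Gb; c = A_gen h \<alpha> Gc; d = A_gen h \<alpha> Gd
      in case (i, j) of
        (S11, S11) \<Rightarrow> a \<oplus>\<^bsub>A\<^esub> a | (S11, S12) \<Rightarrow> b \<oplus>\<^bsub>A\<^esub> b | (S11, S22) \<Rightarrow> \<zero>\<^bsub>A\<^esub>
      | (S12, S11) \<Rightarrow> c       | (S12, S12) \<Rightarrow> a \<oplus>\<^bsub>A\<^esub> d | (S12, S22) \<Rightarrow> b
      | (S22, S11) \<Rightarrow> \<zero>\<^bsub>A\<^esub>     | (S22, S12) \<Rightarrow> c \<oplus>\<^bsub>A\<^esub> c | (S22, S22) \<Rightarrow> d \<oplus>\<^bsub>A\<^esub> d)"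

lemma L2_sym_spec:
  fixes h \<alpha> :: "'k::field_char_0"
  shows L2_sym_eq: "L2_sym h \<alpha> = L2_explicit h \<alpha>"
    and L2_full_preserves_sym:
      "matr_mult (A_alg h \<alpha>) (sym_basis (A_alg h \<alpha>)) (L2_sym h \<alpha>) =
       matr_mult (A_alg h \<alpha>) (L2_full h \<alpha>) (sym_basis (A_alg h \<alpha>))"
proof -
  define A where "A = A_alg h \<alpha>"
  interpret A: ring A unfolding A_def by (rule ring_A_alg)
  have cl [simp]: "A_gen h \<alpha> g \<in> carrier A" "A_const h \<alpha> k \<in> carrier A" for g k
    by (simp_all add: A_def A_gen_closed A_const_closed)
  have half [simp]: "A_const h \<alpha> (1/2) \<otimes>\<^bsub>A\<^esub> (x \<oplus>\<^bsub>A\<^esub> x) = x" if "x \<in> carrier A" for x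
  proof -
    have "A_const h \<alpha> (1/2) \<oplus>\<^bsub>A\<^esub> A_const h \<alpha> (1/2) = \<one>\<^bsub>A\<^esub>"
      by (simp add: A_def flip: A_const_add A_const_one)
    thus ?thesis using that by (metis A.l_distr A.r_distr A.l_one cl(2))
  qed
  have half4: "A_const h \<alpha> (1/2) \<otimes>\<^bsub>A\<^esub> x \<oplus>\<^bsub>A\<^esub> A_const h \<alpha> (1/2) \<otimes>\<^bsub>A\<^esub> x = x" if "x \<in> carrier A" for x
    using half[OF that] that by (simp add: A.r_distr)
  let ?P = "\<lambda>M. M \<in> matr_carrier A \<and>
     matr_mult A (sym_basis A) M = matr_mult A (L2_full h \<alpha>) (sym_basis A)"
  have low: "matr_mult A (sym_basis A) M p s =
      (case p of (V1, V1) \<Rightarrow> M S11 s | (V2, V2) \<Rightarrow> M S22 s | _ \<Rightarrow> M S12 s)"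
    if "M \<in> matr_carrier A" for M :: "(sb, sb, 'k A_elem) matr" and p s
  proof -
    have [simp]: "M i j \<in> carrier A" for i j
      using that by (simp add: matr_carrier_def)
    show ?thesis
      by (cases p) (auto simp: matr_mult_def sym_basis_def UNIV_sb split: vb.splits)
  qed
  have sqc: "L2_explicit h \<alpha> \<in> matr_carrier A"
    by (simp add: L2_explicit_def Let_def matr_carrier_def split: sb.splits flip: A_def)
  have mm: "matr_mult A T W p s =
      T p (V1, V1) \<otimes>\<^bsub>A\<^esub> W (V1, V1) s \<oplus>\<^bsub>A\<^esub> (T p (V1, V2) \<otimes>\<^bsub>A\<^esub> W (V1, V2) s \<oplus>\<^bsub>A\<^esub>
     (T p (V2, V1) \<otimes>\<^bsub>A\<^esub> W (V2, V1) s \<oplus>\<^bsub>A\<^esub> T p (V2, V2) \<otimes>\<^bsub>A\<^esub> W (V2, V2) s))"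
    if "T \<in> matr_carrier A" "W \<in> matr_carrier A"
    for T :: "(vb \<times> vb, vb \<times> vb, 'k A_elem) matr" and W :: "(vb \<times> vb, 'j, 'k A_elem) matr" and p s
  proof -
    have [simp]: "T i j \<in> carrier A" "W j l \<in> carrier A" for i j l
      using that unfolding matr_carrier_def by blast+
    show ?thesis by (simp add: matr_mult_def UNIV_vb_prod)
  qed
  let ?L = "L_matr h \<alpha>"
  let ?d = "\<lambda>i j. if i = j then \<one>\<^bsub>A\<^esub> else \<zero>\<^bsub>A\<^esub>"
  have Lc [simp]: "?L i j \<in> carrier A" for i j
    by (cases i; cases j) (simp_all add: L_matr_def)
  define Q where "Q = (\<lambda>p q. ?d p q \<oplus>\<^bsub>A\<^esub> flip_matr A p q)"
  have Qc: "Q \<in> matr_carrier A"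
    by (auto simp: Q_def matr_carrier_def flip_matr_def)
  have L1: "L1_matr h \<alpha> = (\<lambda>(i, p) (j, q). if p = q then ?L i j else \<zero>\<^bsub>A\<^esub>)"
    by (auto simp: L1_matr_def kronecker_def matr_ring_def fun_eq_iff simp flip: A_def)
  have L1c: "L1_matr h \<alpha> \<in> matr_carrier A"
    by (auto simp: L1 matr_carrier_def)
  have QL: "matr_mult A Q (L1_matr h \<alpha>) = (\<lambda>(i, p) (j, q).
      (if p = q then ?L i j else \<zero>\<^bsub>A\<^esub>) \<oplus>\<^bsub>A\<^esub> (if i = q then ?L p j else \<zero>\<^bsub>A\<^esub>))"
    (is "_ = ?QL")
  proof (intro ext)
    fix p q
    show "matr_mult A Q (L1_matr h \<alpha>) p q = ?QL p q"
      unfolding mm[OF Qc L1c]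
      by (cases p rule: vb_prod_cases; cases q rule: vb_prod_cases)
        (simp_all add: Q_def flip_matr_def L1 A.l_distr)
  qed
  have QLc: "matr_mult A Q (L1_matr h \<alpha>) \<in> matr_carrier A"
    by (auto simp: QL matr_carrier_def)
  have L2: "L2_full h \<alpha> = (\<lambda>(i, p) (j, q). A_const h \<alpha> (1/2) \<otimes>\<^bsub>A\<^esub>
      (((if p = q then ?L i j else \<zero>\<^bsub>A\<^esub>) \<oplus>\<^bsub>A\<^esub> (if i = q then ?L p j else \<zero>\<^bsub>A\<^esub>)) \<oplus>\<^bsub>A\<^esub>
       ((if p = j then ?L i q else \<zero>\<^bsub>A\<^esub>) \<oplus>\<^bsub>A\<^esub> (if i = j then ?L p q else \<zero>\<^bsub>A\<^esub>))))"
    (is "_ = ?L2")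
  proof (intro ext)
    fix p q
    have "L2_full h \<alpha> = matr_scale A (A_const h \<alpha> (1/2)) (matr_mult A (matr_mult A Q (L1_matr h \<alpha>)) Q)"
      by (simp add: L2_full_def Let_def matr_ring_def Q_def flip: A_def)
    hence *: "L2_full h \<alpha> p q =
        A_const h \<alpha> (1/2) \<otimes>\<^bsub>A\<^esub> matr_mult A (matr_mult A Q (L1_matr h \<alpha>)) Q p q"
      by (simp add: matr_scale_def)
    show "L2_full h \<alpha> p q = ?L2 p q"
      unfolding * mm[OF QLc Qc]
      unfolding QL
      by (cases p rule: vb_prod_cases; cases q rule: vb_prod_cases)
        (simp_all add: Q_def flip_matr_def A.r_distr A.a_ac)
  qed
  have L2c: "L2_full h \<alpha> \<in> matr_carrier A"
    by (auto simp: L2 matr_carrier_def)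
  have sbc: "sym_basis A \<in> matr_carrier A"
    by (auto simp: sym_basis_def matr_carrier_def)
  have ex: "?P (L2_explicit h \<alpha>)"
  proof (intro conjI ext sqc)
    fix p s
    show "matr_mult A (sym_basis A) (L2_explicit h \<alpha>) p s = matr_mult A (L2_full h \<alpha>) (sym_basis A) p s"
      unfolding low[OF sqc] mm[OF L2c sbc]
      unfolding L2
      by (cases p rule: vb_prod_cases; cases s)
        (simp_all add: sym_basis_def L2_explicit_def Let_def L_matr_def A.r_distr half4 A.a_ac flip: A_def)
  qed
  have uniq: "M = L2_explicit h \<alpha>" if "?P M" for M
  proof (intro ext)
    fix i j
    have Mc: "M \<in> matr_carrier A" using that by blast
    have eq: "matr_mult A (sym_basis A) M p j = matr_mult A (sym_basis A) (L2_explicit h \<alpha>) p j" for p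
      using that ex by metis
    show "M i j = L2_explicit h \<alpha> i j"
      using eq[of "(V1, V1)"] eq[of "(V1, V2)"] eq[of "(V2, V2)"]
      unfolding low[OF Mc] low[OF sqc] by (cases i) simp_all
  qed
  show "L2_sym h \<alpha> = L2_explicit h \<alpha>"
    unfolding L2_sym_def sym_restriction_def A_def[symmetric]
    using ex uniq by (intro the_equality)
  with ex show "matr_mult (A_alg h \<alpha>) (sym_basis (A_alg h \<alpha>)) (L2_sym h \<alpha>) =
       matr_mult (A_alg h \<alpha>) (L2_full h \<alpha>) (sym_basis (A_alg h \<alpha>))"
    by (simp add: A_def)
qed

end

theory Submission
  imports Defs
begin

text \<open>
  Pull the matrix identity back to the free algebra along the quotient map onto \<open>A\<close>.  Eliminating
  \<open>d = -a\<close>, each of the nine entries of the left-hand side becomes an explicit combination of the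
  four elements \<open>ab - ba - \<hbar>b\<close>, \<open>ac - ca + \<hbar>c\<close>, \<open>bc - cb - 2\<hbar>a\<close> and
  \<open>2a\<^sup>2 + bc + cb + 2\<alpha>\<close> of the kernel; the last one is \<open>-2(\<triangle> - \<alpha>)\<close>.
\<close>

section \<open>Matrices over a ring\<close>

text \<open>Subtraction in \<open>matr_ring R\<close> goes through \<open>a_inv\<close>, which is
  given by a description; uniqueness of additive inverses is what allows it to be computed entrywise
  in \<open>matr_ring_minus\<close>.\<close>

lemma abelian_group_matr_ring:
  assumes "ring R"
  shows "abelian_group (matr_ring R)"
proof -
  interpret ring R by (rule assms)
  have inv: "\<exists>T\<in>matr_carrier R. (\<lambda>i j. S i j \<oplus>\<^bsub>R\<^esub> T i j) = (\<lambda>i j. \<zero>\<^bsub>R\<^esub>)"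
    if "S \<in> matr_carrier R" for S :: "('i, 'i, 'a) matr"
    using that
    by (intro bexI[of _ "\<lambda>i j. \<ominus>\<^bsub>R\<^esub> S i j"]) (auto simp: matr_carrier_def r_neg)
  show ?thesis
    by (rule abelian_groupI)
      (use inv in \<open>auto simp: matr_ring_def matr_carrier_def a_ac fun_eq_iff\<close>)
qed

lemma matr_ring_minus:
  assumes "ring R" "S \<in> matr_carrier R" "T \<in> matr_carrier R"
  shows "S \<ominus>\<^bsub>matr_ring R\<^esub> T = (\<lambda>i j. S i j \<ominus>\<^bsub>R\<^esub> T i j)"
proof -
  interpret ring R by (rule assms)
  interpret M: abelian_group "matr_ring R"
    by (rule abelian_group_matr_ring[OF assms(1)])
  have "\<ominus>\<^bsub>matr_ring R\<^esub> T = (\<lambda>i j. \<ominus>\<^bsub>R\<^esub> T i j)"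
    by (rule M.minus_equality)
      (use assms in \<open>auto simp: matr_ring_def matr_carrier_def l_neg\<close>)
  thus ?thesis
    by (simp add: a_minus_def matr_ring_def)
qed

section \<open>The quotient map from the free algebra\<close>

definition A_class :: "'k::field \<Rightarrow> 'k \<Rightarrow> (gl2, 'k) tensor_alg \<Rightarrow> 'k A_elem" where
  "A_class h \<alpha> t = A_ideal h \<alpha> +>\<^bsub>U_alg h\<^esub> env_class (gl2_bracket h) t"

lemma A_class_ring_hom_ring: "ring_hom_ring tensor_ring (A_alg h \<alpha>) (A_class h \<alpha>)"
proof (rule ring_hom_ringI2[OF ring_tensor_ring ring_A_alg])
  show "A_class h \<alpha> \<in> ring_hom tensor_ring (A_alg h \<alpha>)"
    unfolding A_class_def[abs_def]
    using ring_hom_trans[OF env_class_hom A_class_hom] by (simp add: comp_def)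
qed

lemma
  shows A_class_closed: "A_class h \<alpha> s \<in> carrier (A_alg h \<alpha>)"
    and A_class_add: "A_class h \<alpha> (s + t) = A_class h \<alpha> s \<oplus>\<^bsub>A_alg h \<alpha>\<^esub> A_class h \<alpha> t"
    and A_class_mult: "A_class h \<alpha> (s * t) = A_class h \<alpha> s \<otimes>\<^bsub>A_alg h \<alpha>\<^esub> A_class h \<alpha> t"
    and A_class_minus: "A_class h \<alpha> (s - t) = A_class h \<alpha> s \<ominus>\<^bsub>A_alg h \<alpha>\<^esub> A_class h \<alpha> t"
    and A_class_0: "A_class h \<alpha> 0 = \<zero>\<^bsub>A_alg h \<alpha>\<^esub>"
    and A_class_1: "A_class h \<alpha> 1 = \<one>\<^bsub>A_alg h \<alpha>\<^esub>"
proof -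
  interpret ring_hom_ring tensor_ring "A_alg h \<alpha>" "A_class h \<alpha>"
    by (rule A_class_ring_hom_ring)
  have simps: "carrier tensor_ring = (UNIV :: (gl2, 'a) tensor_alg set)"
    "\<And>x y :: (gl2, 'a) tensor_alg. x \<oplus>\<^bsub>tensor_ring\<^esub> y = x + y"
    "\<And>x y :: (gl2, 'a) tensor_alg. x \<otimes>\<^bsub>tensor_ring\<^esub> y = x * y"
    "\<zero>\<^bsub>tensor_ring\<^esub> = (0 :: (gl2, 'a) tensor_alg)" "\<one>\<^bsub>tensor_ring\<^esub> = (1 :: (gl2, 'a) tensor_alg)"
    by (simp_all add: ring_of_type_algebra_def)
  show closed: "A_class h \<alpha> s \<in> carrier (A_alg h \<alpha>)" for s
    using hom_closed[of s] by (simp add: simps)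
  show add: "A_class h \<alpha> (s + t) = A_class h \<alpha> s \<oplus>\<^bsub>A_alg h \<alpha>\<^esub> A_class h \<alpha> t" for s t
    using hom_add[of s t] by (simp add: simps)
  show "A_class h \<alpha> (s * t) = A_class h \<alpha> s \<otimes>\<^bsub>A_alg h \<alpha>\<^esub> A_class h \<alpha> t"
    using hom_mult[of s t] by (simp add: simps)
  \<comment> \<open>Additivity alone yields compatibility with differences: the type-class
    difference \<open>s - t\<close> is characterised by adding \<open>t\<close> back, with no appeal
    to \<open>a_inv\<close> of \<open>tensor_ring\<close>.\<close>
  have "A_class h \<alpha> s = A_class h \<alpha> (s - t) \<oplus>\<^bsub>A_alg h \<alpha>\<^esub> A_class h \<alpha> t"
    by (simp flip: add)
  thus "A_class h \<alpha> (s - t) = A_class h \<alpha> s \<ominus>\<^bsub>A_alg h \<alpha>\<^esub> A_class h \<alpha> t"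
    by (simp add: closed a_minus_def S.a_assoc S.r_neg)
  show "A_class h \<alpha> 0 = \<zero>\<^bsub>A_alg h \<alpha>\<^esub>" "A_class h \<alpha> 1 = \<one>\<^bsub>A_alg h \<alpha>\<^esub>"
    using hom_zero hom_one by (simp_all add: simps)
qed

lemma A_class_minus_eq_0_iff:
  "A_class h \<alpha> (s - t) = \<zero>\<^bsub>A_alg h \<alpha>\<^esub> \<longleftrightarrow> A_class h \<alpha> s = A_class h \<alpha> t"
proof -
  interpret ring "A_alg h \<alpha>" by (rule ring_A_alg)
  show ?thesis by (simp add: A_class_minus A_class_closed r_right_minus_eq)
qed

text \<open>Matrix products over A can be taken on representatives, that is, in a type-class ring
  where numerals and \<open>algebra_simps\<close> are available.\<close>

lemma matr_ring_mult_A_class: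
  "(\<lambda>i j. A_class h \<alpha> (S i j)) \<otimes>\<^bsub>matr_ring (A_alg h \<alpha>)\<^esub> (\<lambda>i j. A_class h \<alpha> (T i j)) =
     (\<lambda>i j. A_class h \<alpha> (\<Sum>k\<in>UNIV. S i k * T k j))"
proof -
  interpret ring "A_alg h \<alpha>" by (rule ring_A_alg)
  have sum: "A_class h \<alpha> (\<Sum>k\<in>I. f k) = (\<Oplus>\<^bsub>A_alg h \<alpha>\<^esub>k\<in>I. A_class h \<alpha> (f k))"
    if "finite I" for I and f :: "'c \<Rightarrow> _"
    using that by induction (auto simp: A_class_0 A_class_add A_class_closed)
  thus ?thesis
    by (simp add: matr_ring_def matr_mult_def sum flip: A_class_mult)
qed

section \<open>Relations in the kernel\<close>

abbreviation tensor_gen :: "'g::finite \<Rightarrow> ('g, 'k::field) tensor_alg" where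
  "tensor_gen g \<equiv> tensor_incl (unit_vec g)"

lemma A_gen_eq_A_class: "A_gen h \<alpha> g = A_class h \<alpha> (tensor_gen g)"
  by (simp add: A_gen_def U_gen_def A_class_def)

lemma A_const_eq_A_class: "A_const h \<alpha> k = A_class h \<alpha> (tensor_const k)"
  by (simp add: A_const_def U_const_def A_class_def)

lemma
  shows tensor_const_add: "tensor_const (k + m) = tensor_const k + tensor_const m"
    and tensor_const_mult: "tensor_const (k * m) = tensor_const k * tensor_const m"
    and tensor_const_1: "tensor_const 1 = 1"
  by (simp_all add: tensor_const_def Poly_Mapping.single_add mult_single)

text \<open>Turns the scalars 4 and 8 of the matrix identity into the numerals that occur in
  \<open>char_entry\<close>.\<close>

lemma tensor_const_numeral: "tensor_const (numeral n) = numeral n"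
proof -
  have "tensor_const (of_nat m) = of_nat m" for m
    by (induction m) (simp_all add: tensor_const_add tensor_const_1, simp add: tensor_const_def)
  from this[of "numeral n"] show ?thesis by simp
qed

text \<open>With \<open>tensor_incl_mult_const\<close> this supplies the centrality hypotheses of
  \<open>char_entry_mem\<close>; they hold already in the free algebra.\<close>

lemma tensor_const_mult_commute: "tensor_const k * tensor_const m = tensor_const m * tensor_const k"
  by (simp add: mult.commute flip: tensor_const_mult)

lemma tensor_incl_const_mult: "tensor_incl (\<lambda>i. k * x i) = tensor_const k * tensor_incl x"
  by (simp add: tensor_incl_def tensor_const_def mult_single sum_distrib_left)

lemma tensor_incl_mult_const: "tensor_incl x * tensor_const k = tensor_const k * tensor_incl x"
  by (simp add: tensor_incl_def tensor_const_def mult_single sum_distrib_left sum_distrib_right mult.commute)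

lemma tensor_incl_diff: "tensor_incl (\<lambda>i. x i - y i) = tensor_incl x - tensor_incl y"
  by (simp add: tensor_incl_def Poly_Mapping.single_diff sum_subtractf)

lemma A_class_bracket:
  "A_class h \<alpha> (tensor_incl x * tensor_incl y - tensor_incl y * tensor_incl x
     - tensor_incl (gl2_bracket h x y)) = \<zero>\<^bsub>A_alg h \<alpha>\<^esub>" (is "A_class h \<alpha> ?t = _")
proof -
  interpret I: ideal "env_ideal (gl2_bracket h)" tensor_ring by (rule ideal_env_ideal)
  have "?t \<in> env_ideal (gl2_bracket h)"
    unfolding env_ideal_def
    by (rule subsetD[OF ring.genideal_self[OF ring_tensor_ring]])
      (auto simp: ring_of_type_algebra_def)
  hence "env_class (gl2_bracket h) ?t = \<zero>\<^bsub>U_alg h\<^esub>"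
    by (simp add: env_class_def env_alg_def FactRing_def I.a_rcos_const)
  thus ?thesis
    using ring_hom_zero[OF A_class_hom ring_env_alg ring_A_alg] by (simp add: A_class_def)
qed

text \<open>The relations of \<open>A_ideal\<close> live in the enveloping algebra, while the
  computation takes place one level below; any lift of such a relation to the free algebra is killed
  by the composite quotient map.\<close>

lemma A_class_eq_0I:
  assumes "env_class (gl2_bracket h) t \<in> {U_trace h, U_Delta h \<ominus>\<^bsub>U_alg h\<^esub> U_const h \<alpha>}"
  shows "A_class h \<alpha> t = \<zero>\<^bsub>A_alg h \<alpha>\<^esub>"
proof -
  interpret I: ideal "A_ideal h \<alpha>" "U_alg h" by (rule ideal_A_ideal)
  have "env_class (gl2_bracket h) t \<in> A_ideal h \<alpha>"
    unfolding A_ideal_def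
    by (rule subsetD[OF ring.genideal_self[OF ring_env_alg] assms])
      (auto simp: U_trace_def U_Delta_def U_gen_def U_const_def env_class_closed
        intro!: I.a_closed I.minus_closed I.m_closed)
  thus ?thesis
    by (simp add: A_class_def A_alg_def FactRing_def I.a_rcos_const)
qed

lemma
  shows env_class_add: "env_class br (s + t) = env_class br s \<oplus>\<^bsub>env_alg br\<^esub> env_class br t"
    and env_class_mult: "env_class br (s * t) = env_class br s \<otimes>\<^bsub>env_alg br\<^esub> env_class br t"
    and env_class_minus: "env_class br (s - t) = env_class br s \<ominus>\<^bsub>env_alg br\<^esub> env_class br t"
proof -
  show add: "env_class br (s + t) = env_class br s \<oplus>\<^bsub>env_alg br\<^esub> env_class br t" for s t
    using ring_hom_add[OF env_class_hom, of s t br] by (simp add: ring_of_type_algebra_def)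
  show "env_class br (s * t) = env_class br s \<otimes>\<^bsub>env_alg br\<^esub> env_class br t"
    using ring_hom_mult[OF env_class_hom, of s t br] by (simp add: ring_of_type_algebra_def)
  interpret ring "env_alg br" by (rule ring_env_alg)
  have "env_class br s = env_class br (s - t) \<oplus>\<^bsub>env_alg br\<^esub> env_class br t"
    by (simp flip: add)
  thus "env_class br (s - t) = env_class br s \<ominus>\<^bsub>env_alg br\<^esub> env_class br t"
    by (simp add: env_class_closed a_minus_def a_assoc r_neg)
qed

lemma A_class_trace: "A_class h \<alpha> (tensor_gen Ga + tensor_gen Gd) = \<zero>\<^bsub>A_alg h \<alpha>\<^esub>"
  by (rule A_class_eq_0I) (simp add: U_trace_def U_gen_def env_class_add)

lemma A_class_Delta:
  "A_class h \<alpha> (tensor_gen Ga * tensor_gen Gd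
     - tensor_const (1/2) * (tensor_gen Gb * tensor_gen Gc + tensor_gen Gc * tensor_gen Gb)
     - tensor_const \<alpha>) = \<zero>\<^bsub>A_alg h \<alpha>\<^esub>"
  by (rule A_class_eq_0I)
    (simp add: U_Delta_def U_gen_def U_const_def env_class_add env_class_mult env_class_minus)

section \<open>The Cayley-Hamilton identity in the free algebra\<close>

lemma numeral_mult_commute: "x * numeral n = numeral n * (x :: 'r::ring_1)"
  by (metis mult_of_nat_commute of_nat_numeral)

context
  fixes a b c h y :: "'r::ring_1"
begin

text \<open>The matrix of L_(2) after eliminating d = -a, over an arbitrary ring. The context
  elements \<open>h\<close> and \<open>y\<close> stand for the scalars \<hbar> and \<alpha>.\<close>

fun sym_square :: "sb \<Rightarrow> sb \<Rightarrow> 'r" where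
  "sym_square S11 S11 = 2 * a" | "sym_square S11 S12 = 2 * b" | "sym_square S11 S22 = 0"
| "sym_square S12 S11 = c" | "sym_square S12 S12 = 0" | "sym_square S12 S22 = b"
| "sym_square S22 S11 = 0" | "sym_square S22 S12 = 2 * c" | "sym_square S22 S22 = - 2 * a"

text \<open>An entry of the Cayley-Hamilton polynomial. The cube is associated as (T T) T because
  \<open>[^]\<close> multiplies on the right.\<close>

definition char_entry :: "sb \<Rightarrow> sb \<Rightarrow> 'r" where
  "char_entry i j =
     (\<Sum>k\<in>UNIV. (\<Sum>l\<in>UNIV. sym_square i l * sym_square l k) * sym_square k j)
     - 4 * h * (\<Sum>k\<in>UNIV. sym_square i k * sym_square k j)
     + 4 * (y + h * h) * sym_square i j - 8 * h * y * (if i = j then 1 else 0)"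

text \<open>\<open>K\<close> plays the role of the kernel, a two-sided ideal. Since \<open>h\<close>
  and \<open>y\<close> commute with everything exactly and not just modulo \<open>K\<close>, the
  entries can be expressed through the relations by equations in the ring itself.\<close>

lemma char_entry_mem:
  assumes central: "a * h = h * a" "b * h = h * b" "c * h = h * c" "y * h = h * y"
      "a * y = y * a" "b * y = y * b" "c * y = y * c"
    and add: "\<And>u v. u \<in> K \<Longrightarrow> v \<in> K \<Longrightarrow> u + v \<in> K"
    and left: "\<And>u v. v \<in> K \<Longrightarrow> u * v \<in> K"
    and right: "\<And>u v. u \<in> K \<Longrightarrow> u * v \<in> K"
    and rel: "a * b - b * a - h * b \<in> K" "a * c - c * a + h * c \<in> K"
      "b * c - c * b - 2 * h * a \<in> K" "2 * a * a + b * c + c * b + 2 * y \<in> K"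
  shows "char_entry i j \<in> K"
proof -
  have minus: "u - v \<in> K" if "u \<in> K" "v \<in> K" for u v
    using add[OF that(1) left[OF that(2), of "- 1"]] by simp
  have uminus: "- u \<in> K" if "u \<in> K" for u
    using left[OF that, of "- 1"] by simp
  \<comment> \<open>\<open>algebra_simps\<close> nests products to the right, so a commutation rule
    also needs a version with a tail \<open>z\<close>. Together with \<open>num\<close>, these rules
    move numerals and the scalars \<open>h\<close>, \<open>y\<close> to the front of each
    monomial.\<close>
  have pull: "a * (h * z) = h * (a * z)" "b * (h * z) = h * (b * z)" "c * (h * z) = h * (c * z)"
    "y * (h * z) = h * (y * z)" "a * (y * z) = y * (a * z)" "b * (y * z) = y * (b * z)"
    "c * (y * z) = y * (c * z)" for z
    by (simp_all add: central flip: mult.assoc)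
  have num: "x * numeral n = numeral n * x" "x * (numeral n * z) = numeral n * (x * z)"
    if "x \<in> {a, b, c, h, y}" for x z n
    by (simp_all add: numeral_mult_commute flip: mult.assoc)
  note nums = num[of a, simplified] num[of b, simplified] num[of c, simplified]
    num[of h, simplified] num[of y, simplified]
  \<comment> \<open>Merges multiples of the same monomial. It reverses distributivity, hence it is
    applied in a second pass after \<open>expand\<close>.\<close>
  have collect: "numeral m * x + numeral n * x = numeral (m + n) * x"
    "numeral m * x + (numeral n * x + z) = numeral (m + n) * x + z" for m n and x z :: 'r
    by (simp_all add: distrib_right flip: numeral_plus_numeral add.assoc)
  define r1 where "r1 = a * b - b * a - h * b"
  define r2 where "r2 = a * c - c * a + h * c"
  define r3 where "r3 = b * c - c * b - 2 * h * a"
  define r4 where "r4 = 2 * a * a + b * c + c * b + 2 * y"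
  note expand = r1_def r2_def r3_def r4_def char_entry_def UNIV_sb central pull nums algebra_simps
  \<comment> \<open>Two gradings dictate the shape. Counting \<open>b\<close> as 1 and
    \<open>c\<close> as -1, the entry in row i and column j has weight j - i, while
    \<open>r1\<close>, \<open>r2\<close>, \<open>r3\<close>, \<open>r4\<close> have weights 1, -1,
    0, 0. With \<open>a\<close>, \<open>b\<close>, \<open>c\<close>, \<open>h\<close> of degree 1
    and \<open>y\<close> of degree 2, entries have degree 3 and relations degree 2, so each relation
    gets linear factors. For example, the upper right corner comes from ab^2 - b^2 a = [a,b]b +
    b[a,b], whose value 2hb^2 modulo \<open>r1\<close> cancels against the square term.\<close>
  have "char_entry i j = (case (i, j) of
      (S11, S11) \<Rightarrow> 4 * (a - h) * (r3 + r4) - 4 * b * r2 - 4 * r1 * c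
    | (S11, S12) \<Rightarrow> 4 * b * r4 + 8 * (a * r1 + r1 * a - h * r1)
    | (S11, S22) \<Rightarrow> 4 * (r1 * b + b * r1)
    | (S12, S11) \<Rightarrow> 2 * r4 * c + 4 * (h * r2 - a * r2 - r2 * a)
    | (S12, S12) \<Rightarrow> 4 * r1 * c - 4 * r2 * b - 4 * a * r3 - 4 * h * r4
    | (S12, S22) \<Rightarrow> 2 * r4 * b - 4 * (a * r1 + r1 * a + h * r1)
    | (S22, S11) \<Rightarrow> - 4 * (r2 * c + c * r2)
    | (S22, S12) \<Rightarrow> 4 * c * r4 + 8 * (a * r2 + r2 * a + h * r2)
    | (S22, S22) \<Rightarrow> 4 * c * r1 + 4 * r2 * b - 4 * (a + h) * (r4 - r3))"
    by (cases i; cases j) (simp_all add: expand, simp_all add: collect)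
  moreover have "r1 \<in> K" "r2 \<in> K" "r3 \<in> K" "r4 \<in> K"
    using rel by (simp_all add: r1_def r2_def r3_def r4_def)
  ultimately show ?thesis
    by (cases i; cases j) (simp_all add: add minus uminus left right)
qed

end

section \<open>Transfer to \<open>A\<close>\<close>

lemma matr_ring_one_A_class:
  "\<one>\<^bsub>matr_ring (A_alg h \<alpha>)\<^esub> = (\<lambda>i j. A_class h \<alpha> (if i = j then 1 else 0))"
  by (auto simp: matr_ring_def A_class_0 A_class_1 fun_eq_iff)

lemma L2_sym_eq_A_class:
  fixes h \<alpha> :: "'k::field_char_0"
  shows "L2_sym h \<alpha> =
    (\<lambda>i j. A_class h \<alpha> (sym_square (tensor_gen Ga) (tensor_gen Gb) (tensor_gen Gc) i j))"
proof -
  interpret A: ring "A_alg h \<alpha>" by (rule ring_A_alg)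
  let ?a = "tensor_gen Ga :: (gl2, 'k) tensor_alg" and ?d = "tensor_gen Gd :: (gl2, 'k) tensor_alg"
  \<comment> \<open>The last diagonal entry is d + d in \<open>L2_explicit\<close> but -2a in
    \<open>sym_square\<close>; twice the trace relation identifies them. The middle entry a + d
    vanishes by the trace relation directly.\<close>
  have "A_class h \<alpha> (2 * (?a + ?d)) = \<zero>\<^bsub>A_alg h \<alpha>\<^esub>"
    by (subst A_class_mult) (simp add: A_class_trace A_class_closed)
  hence "A_class h \<alpha> ((?d + ?d) - (- (2 * ?a))) = \<zero>\<^bsub>A_alg h \<alpha>\<^esub>"
    by (simp add: algebra_simps flip: mult_2)
  hence "A_class h \<alpha> (?d + ?d) = A_class h \<alpha> (- (2 * ?a))"
    by (simp only: A_class_minus_eq_0_iff)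
  thus ?thesis
    unfolding L2_sym_eq
    by (intro ext; rename_tac i j; case_tac i; case_tac j)
      (simp_all add: L2_explicit_def A_gen_eq_A_class A_class_0 A_class_trace mult_2
        flip: A_class_add)
qed

lemma A_class_char_entry:
  fixes h \<alpha> :: "'k::field_char_0"
  shows "A_class h \<alpha> (char_entry (tensor_gen Ga) (tensor_gen Gb) (tensor_gen Gc)
    (tensor_const h) (tensor_const \<alpha>) i j) = \<zero>\<^bsub>A_alg h \<alpha>\<^esub>"
proof -
  interpret A: ring "A_alg h \<alpha>" by (rule ring_A_alg)
  define K where "K = {t. A_class h \<alpha> t = \<zero>\<^bsub>A_alg h \<alpha>\<^esub>}"
  define a b c d :: "(gl2, 'k) tensor_alg"
    where abcd: "a = tensor_gen Ga" "b = tensor_gen Gb" "c = tensor_gen Gc" "d = tensor_gen Gd"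
  define H y :: "(gl2, 'k) tensor_alg" where Hy: "H = tensor_const h" "y = tensor_const \<alpha>"
  have add: "u + v \<in> K" if "u \<in> K" "v \<in> K" for u v
    using that by (simp add: K_def A_class_add)
  have left: "u * v \<in> K" if "v \<in> K" for u v
    using that by (simp add: K_def A_class_mult A_class_closed)
  have right: "u * v \<in> K" if "u \<in> K" for u v
    using that by (simp add: K_def A_class_mult A_class_closed)
  \<comment> \<open>The bracket [c,a] is used instead of [a,c] so that its scalar is
    \<open>h\<close> and not \<open>- h\<close>, as \<open>tensor_incl_const_mult\<close> then
    produces \<open>H\<close>; the sign is restored when deriving \<open>r2\<close>.\<close>
  have bracket: "gl2_bracket h (unit_vec Ga) (unit_vec Gb) = (\<lambda>i. h * unit_vec Gb i)"
    "gl2_bracket h (unit_vec Gc) (unit_vec Ga) = (\<lambda>i. h * unit_vec Gc i)"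
    "gl2_bracket h (unit_vec Gb) (unit_vec Gc) = (\<lambda>i. h * (unit_vec Ga i - unit_vec Gd i))"
    by (rule ext, rename_tac i, case_tac i; simp add: gl2_bracket_simps unit_vec_def)+
  have r1: "a * b - b * a - H * b \<in> K"
    using A_class_bracket[of h \<alpha> "unit_vec Ga" "unit_vec Gb"]
    by (simp add: K_def abcd Hy bracket tensor_incl_const_mult)
  have "c * a - a * c - H * c \<in> K"
    using A_class_bracket[of h \<alpha> "unit_vec Gc" "unit_vec Ga"]
    by (simp add: K_def abcd Hy bracket tensor_incl_const_mult)
  from left[OF this, of "- 1"] have r2: "a * c - c * a + H * c \<in> K"
    by (simp add: algebra_simps)
  have trace: "a + d \<in> K"
    by (simp add: K_def abcd A_class_trace)
  have "b * c - c * b - H * (a - d) \<in> K"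
    using A_class_bracket[of h \<alpha> "unit_vec Gb" "unit_vec Gc"]
    by (simp add: K_def abcd Hy bracket tensor_incl_const_mult tensor_incl_diff)
  \<comment> \<open>Subtracting H(a + d) replaces H(a - d) by 2Ha, which removes d.\<close>
  from add[OF this left[OF trace, of "- H"]] have r3: "b * c - c * b - 2 * H * a \<in> K"
    by (simp add: algebra_simps mult_2)
  have "(2 :: (gl2, 'k) tensor_alg) * tensor_const (1/2) = 1"
    by (simp add: tensor_const_1 flip: tensor_const_numeral tensor_const_mult)
  hence half: "2 * (tensor_const (1/2) * t) = t" for t :: "(gl2, 'k) tensor_alg"
    by (simp flip: mult.assoc)
  have "a * d - tensor_const (1/2) * (b * c + c * b) - y \<in> K"
    by (simp add: K_def abcd Hy A_class_Delta)
  \<comment> \<open>The factor -2 clears the denominator; adding 2a(a + d) afterwards trades -2ad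
    for 2a^2.\<close>
  from left[OF this, of "- 2"] have "(b * c + c * b) + 2 * y - 2 * (a * d) \<in> K"
    by (simp add: right_diff_distrib half, simp add: algebra_simps)
  from add[OF this left[OF trace, of "2 * a"]] have r4: "2 * a * a + b * c + c * b + 2 * y \<in> K"
    by (simp add: algebra_simps)
  have "char_entry a b c H y i j \<in> K"
    by (rule char_entry_mem[OF _ _ _ _ _ _ _ add left right r1 r2 r3 r4])
      (simp_all add: abcd Hy tensor_incl_mult_const tensor_const_mult_commute)
  thus ?thesis by (simp add: K_def abcd Hy)
qed

text \<open>Every operation in the identity is pushed inside \<open>A_class\<close>, which leaves
  the class of \<open>char_entry\<close> in each position. A general field of characteristic zero
  covers the real and the complex case at once.\<close>

lemma L2_sym_Cayley_Hamilton:
  fixes h \<alpha> :: "'k::field_char_0"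
  shows "let A = A_alg h \<alpha>; M = matr_ring A; T = L2_sym h \<alpha>;
           scale = (\<lambda>k. matr_scale A (A_const h \<alpha> k))
       in T [^]\<^bsub>M\<^esub> (3::nat) \<ominus>\<^bsub>M\<^esub> scale (4 * h) (T [^]\<^bsub>M\<^esub> (2::nat))
            \<oplus>\<^bsub>M\<^esub> scale (4 * (\<alpha> + h^2)) T \<ominus>\<^bsub>M\<^esub> scale (8 * h * \<alpha>) \<one>\<^bsub>M\<^esub> = \<zero>\<^bsub>M\<^esub>"
proof -
  let ?M = "matr_ring (A_alg h \<alpha>) :: (sb, sb, 'k A_elem) matr ring"
  let ?cls = "\<lambda>S :: (sb, sb, (gl2, 'k) tensor_alg) matr. \<lambda>i j. A_class h \<alpha> (S i j)"
  define T where "T = sym_square (tensor_gen Ga :: (gl2, 'k) tensor_alg) (tensor_gen Gb) (tensor_gen Gc)"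
  have T: "L2_sym h \<alpha> = ?cls T"
    by (simp add: L2_sym_eq_A_class T_def)
  \<comment> \<open>Powers start their recursion at the identity matrix. The left unit law is
    checked on representatives, as only the additive group structure of \<open>matr_ring\<close> has
    been established.\<close>
  have one_mult: "\<one>\<^bsub>?M\<^esub> \<otimes>\<^bsub>?M\<^esub> ?cls T = ?cls T"
    by (simp add: matr_ring_one_A_class matr_ring_mult_A_class if_distrib[of "\<lambda>x. x * _"] cong: if_cong)
  have pow: "?cls T [^]\<^bsub>?M\<^esub> (2::nat) = ?cls (\<lambda>i j. \<Sum>k\<in>UNIV. T i k * T k j)"
    "?cls T [^]\<^bsub>?M\<^esub> (3::nat) = ?cls (\<lambda>i j. \<Sum>k\<in>UNIV. (\<Sum>l\<in>UNIV. T i l * T l k) * T k j)"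
    by (simp_all add: numeral_2_eq_2 numeral_3_eq_3 nat_pow_def one_mult matr_ring_mult_A_class)
  have scale: "matr_scale (A_alg h \<alpha>) (A_const h \<alpha> k) (?cls S) = ?cls (\<lambda>i j. tensor_const k * S i j)" for k S
    by (simp add: matr_scale_def A_const_eq_A_class A_class_mult)
  have plus: "?cls S \<oplus>\<^bsub>?M\<^esub> ?cls S' = ?cls (\<lambda>i j. S i j + S' i j)" for S S'
    by (simp add: matr_ring_def A_class_add)
  have minus: "?cls S \<ominus>\<^bsub>?M\<^esub> ?cls S' = ?cls (\<lambda>i j. S i j - S' i j)" for S S'
    by (subst matr_ring_minus[OF ring_A_alg]) (simp_all add: matr_carrier_def A_class_closed A_class_minus)
  have zero: "\<zero>\<^bsub>?M\<^esub> = (\<lambda>i j. \<zero>\<^bsub>A_alg h \<alpha>\<^esub>)"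
    by (simp add: matr_ring_def)
  show ?thesis
    unfolding Let_def T pow matr_ring_one_A_class scale plus minus zero
    using A_class_char_entry[of h \<alpha>]
    by (simp add: char_entry_def T_def tensor_const_add tensor_const_mult tensor_const_numeral
        power2_eq_square)
qed

theorem proposition4:
  shows "(\<forall>h \<alpha> :: real. h \<noteq> 0 \<longrightarrow>
      (let A = A_alg h \<alpha>; M = matr_ring A; T = L2_sym h \<alpha>;
           scale = (\<lambda>k. matr_scale A (A_const h \<alpha> k))
       in T [^]\<^bsub>M\<^esub> (3::nat) \<ominus>\<^bsub>M\<^esub> scale (4 * h) (T [^]\<^bsub>M\<^esub> (2::nat))
            \<oplus>\<^bsub>M\<^esub> scale (4 * (\<alpha> + h^2)) T \<ominus>\<^bsub>M\<^esub> scale (8 * h * \<alpha>) \<one>\<^bsub>M\<^esub> = \<zero>\<^bsub>M\<^esub>))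
    \<and> (\<forall>h \<alpha> :: complex. h \<noteq> 0 \<longrightarrow>
      (let A = A_alg h \<alpha>; M = matr_ring A; T = L2_sym h \<alpha>;
           scale = (\<lambda>k. matr_scale A (A_const h \<alpha> k))
       in T [^]\<^bsub>M\<^esub> (3::nat) \<ominus>\<^bsub>M\<^esub> scale (4 * h) (T [^]\<^bsub>M\<^esub> (2::nat))
            \<oplus>\<^bsub>M\<^esub> scale (4 * (\<alpha> + h^2)) T \<ominus>\<^bsub>M\<^esub> scale (8 * h * \<alpha>) \<one>\<^bsub>M\<^esub> = \<zero>\<^bsub>M\<^esub>))"
  by (intro conjI allI impI L2_sym_Cayley_Hamilton)

end
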